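(* Let $m\ge 0$ be an integer and let $a_1,a_2$ be real numbers with $1+a_1+a_2>0$ and $a_2+4>-\sqrt{8(1+a_1+a_2)}$. Put $c_1:=a_2+4$, $c_2:=1+a_1+a_2$, and for integers $n,k,j$ in the ranges below define $$t_{k,j}(m,n;a_1,a_2):=\pi\,2^{-(3m+2+k+j)/2}\,c_2^{(m-k-j)/2}\,\bigl(c_1+\sqrt{8c_2}\bigr)^{j-m-1/2}\binom{4m-n-k+2}{k-n}\binom{2m-2j}{m-j}\binom{m-k+j}{2j}\binom{2j}{j}\binom{m}{j}^{-1}.$$ Then for every integer $n$ with $m+1\le n\le 2m+1$, $$\int_0^\infty\frac{z^{2n}\,dz}{(z^8+a_2z^6+2a_1z^4+a_2z^2+1)^{m+1}}=\sum_{k=n}^{2m+1}\sum_{j=0}^{k-m-1}t_{k,j}(m,n;a_1,a_2),$$ and for every integer $n$ with $0\le n\le m$, $$\int_0^\infty\frac{z^{2n}\,dz}{(z^8+a_2z^6+2a_1z^4+a_2z^2+1)^{m+1}}=\sum_{k=n}^{m}\sum_{j=0}^{m-k}t_{k,j}(m,n;a_1,a_2)+\sum_{k=m+1}^{2m+1}\sum_{j=0}^{k-m-1}t_{k,j}(m,n;a_1,a_2).$$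
   Context: Binomial coefficients with possibly negative upper entry are the generalized ones: $\binom{x}{r}=\frac{x(x-1)\cdots(x-r+1)}{r!}$ for any integer $x$ and integer $r\ge 0$ (so $\binom{x}{0}=1$). *)

theory Defs
  imports "HOL-Analysis.Analysis"
begin

(* The upper entries are formed in the reals because m - k + j is a negative integer whenever
   k > m and j \<le> k - m - 1. The lower entries k - n and m - j use truncated subtraction, which is
   exact here: every sum of the theorem has k \<ge> n and j \<le> m. *)
definition t_coeff :: "nat \<Rightarrow> nat \<Rightarrow> real \<Rightarrow> real \<Rightarrow> nat \<Rightarrow> nat \<Rightarrow> real" where
  "t_coeff m n a1 a2 k j =
    (let c1 = a2 + 4; c2 = 1 + a1 + a2 in
      pi * 2 powr (- (3 * real m + 2 + real k + real j) / 2)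
         * c2 powr ((real m - real k - real j) / 2)
         * (c1 + sqrt (8 * c2)) powr (real j - real m - 1 / 2)
         * ((4 * real m - real n - real k + 2) gchoose (k - n))
         * ((2 * real m - 2 * real j) gchoose (m - j))
         * ((real m - real k + real j) gchoose (2 * j))
         * real ((2 * j) choose j)
         * inverse (real (m choose j)))"

end

theory Submission
  imports Defs
begin

text \<open>The octic is \<open>z^4 (y^4 + c1 y^2 + 2 c2)\<close> with \<open>y = z - 1/z\<close>. For \<open>z = exp \<theta>\<close>, symmetrising
  under \<open>z \<mapsto> 1/z\<close> turns \<open>dz / z^(2N+2)\<close> into \<open>(cosh ((2N+1)\<theta>) / cosh \<theta>) dy\<close>, whose weight is the
  polynomial \<open>\<Sum>i. binom(N+i, 2i) y^(2i)\<close>. So the integral is a binomial combination of quartic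
  integrals. After scaling \<open>y = sqrt s v\<close> with \<open>s = sqrt (2 c2)\<close> the quartic is itself
  \<open>v^2 ((v - 1/v)^2 + p)\<close> up to a factor, so the same substitution applies a second time and leaves
  the Beta integrals of \<open>y^(2j) / (y^2 + p)^(m+1)\<close>. The index \<open>i\<close> is \<open>2m+1-k\<close> in the formula for
  \<open>t\<close>.\<close>

section \<open>Change of variables for nonnegative integrands\<close>

text \<open>Nonnegativity turns the given integrability over \<open>T\<close> into absolute
  integrability, which is what the change of variables theorem for injective maps transports. The
  absolute value of \<open>g'\<close> admits decreasing maps, so inversions are covered as
  well.\<close>

lemma has_integral_nonneg_substitution:
  fixes f g g' :: "real \<Rightarrow> real"
  assumes "S \<in> sets lebesgue"
    and "\<And>x. x \<in> S \<Longrightarrow> (g has_field_derivative g' x) (at x within S)"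
    and "inj_on g S" and "g ` S = T"
    and "\<And>y. y \<in> T \<Longrightarrow> f y \<ge> 0" and "(f has_integral b) T"
    and "\<And>x. x \<in> S \<Longrightarrow> h x = \<bar>g' x\<bar> * f (g x)"
  shows "(h has_integral b) S"
proof -
  have "f absolutely_integrable_on T" "integral T f = b"
    using assms(5,6) by (auto intro!: nonnegative_absolutely_integrable_1)
  then have "(\<lambda>x. \<bar>g' x\<bar> * f (g x)) absolutely_integrable_on S"
    "integral S (\<lambda>x. \<bar>g' x\<bar> * f (g x)) = b"
    using has_absolute_integral_change_of_variables_1'[OF assms(1-3), of f b] assms(4) by auto
  then have "((\<lambda>x. \<bar>g' x\<bar> * f (g x)) has_integral b) S"
    by (simp add: has_integral_iff set_lebesgue_integral_eq_integral(1))
  then show ?thesis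
    using assms(7) by (simp cong: has_integral_cong)
qed

lemma has_integral_insert_point:
  fixes f :: "real \<Rightarrow> real"
  assumes "(f has_integral I) S"
  shows "(f has_integral I) (insert a S)"
proof -
  have "negligible {x \<in> insert a S - S. f x \<noteq> 0}"
    by (rule negligible_subset[OF negligible_sing[of a]]) auto
  moreover have "negligible {x \<in> S - insert a S. f x \<noteq> 0}"
    by (rule empty_imp_negligible) auto
  ultimately show ?thesis
    using has_integral_spike_set_eq assms by blast
qed

section \<open>Polynomial expansion of the symmetrised weight\<close>

text \<open>With \<open>u = 1/z = exp (- \<theta>)\<close> these are the expansions of \<open>cosh ((2d+1)\<theta>) / cosh \<theta>\<close> and
  \<open>sinh ((2d+2)\<theta>) / sinh (2\<theta>)\<close> in powers of \<open>2 sinh \<theta>\<close>, which Pascal's rule proves jointly.\<close>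

lemma odd_cosh_expansion_aux:
  fixes z u :: real
  assumes "z * u = 1"
  shows "(1 + u^2) * (\<Sum>j\<le>d. real ((d + j) choose (2 * j)) * (z - u) ^ (2 * j))
           = z ^ (2 * d) + u ^ (2 * d + 2) \<and>
         (1 + u^2) * (z - u)^2 * (\<Sum>j\<le>d. real ((d + j + 1) choose (2 * j + 1)) * (z - u) ^ (2 * j))
           = (1 - u^2) * (z ^ (2 * d + 2) - u ^ (2 * d + 2))"
proof (induction d)
  case 0
  have "z^2 * u^2 = 1"
    using assms by (metis power_mult_distrib power_one)
  then have "(1 + u^2) * (z - u)^2 = (1 - u^2) * (z^2 - u^2)"
    using assms by algebra
  then show ?case by (simp add: power2_eq_square)
next
  case (Suc d)
  define P where "P d = (\<Sum>j\<le>d. real ((d + j) choose (2 * j)) * (z - u) ^ (2 * j))" for d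
  define Q where "Q d = (\<Sum>j\<le>d. real ((d + j + 1) choose (2 * j + 1)) * (z - u) ^ (2 * j))" for d
  \<comment> \<open>Split off \<open>j = 0\<close>, shift the index and apply Pascal's rule to
    \<open>(d + j + 2) choose (2 * j + 2)\<close>. One part restores \<open>P d\<close>, since its
    extra top term is \<open>(2 * d + 1) choose (2 * d + 2) = 0\<close>; the other is
    \<open>Q d\<close> times the square.\<close>
  have P: "P (Suc d) = P d + (z - u)^2 * Q d"
  proof -
    have "P (Suc d) = 1 + (\<Sum>j\<le>d. real ((d + j + 2) choose (2 * j + 2)) * (z - u) ^ (2 * j + 2))"
      unfolding P_def by (subst sum.atMost_Suc_shift) (simp add: algebra_simps)
    also have "(\<Sum>j\<le>d. real ((d + j + 2) choose (2 * j + 2)) * (z - u) ^ (2 * j + 2)) =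
        (\<Sum>j\<le>d. real ((d + Suc j) choose (2 * Suc j)) * (z - u) ^ (2 * Suc j)) + (z - u)^2 * Q d"
      unfolding Q_def sum_distrib_left sum.distrib[symmetric]
      by (intro sum.cong refl) (simp add: algebra_simps power2_eq_square)
    also have "(\<Sum>j\<le>d. real ((d + Suc j) choose (2 * Suc j)) * (z - u) ^ (2 * Suc j)) =
        (\<Sum>j\<le>Suc d. real ((d + j) choose (2 * j)) * (z - u) ^ (2 * j)) - 1"
      by (subst sum.atMost_Suc_shift) simp
    also have "(\<Sum>j\<le>Suc d. real ((d + j) choose (2 * j)) * (z - u) ^ (2 * j)) = P d"
      unfolding P_def by (simp add: binomial_eq_0)
    finally show ?thesis by simp
  qed
  \<comment> \<open>Pascal's rule again, but the second part is \<open>P\<close> at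
    \<open>Suc d\<close>, not at \<open>d\<close>. This is why the closed form of
    \<open>P (Suc d)\<close> is derived before that of \<open>Q (Suc d)\<close>.\<close>
  have Q: "Q (Suc d) = Q d + P (Suc d)"
  proof -
    have "Q (Suc d) = (\<Sum>j\<le>Suc d. real ((d + j + 1) choose (2 * j + 1)) * (z - u) ^ (2 * j)) + P (Suc d)"
      unfolding P_def Q_def sum.distrib[symmetric]
      by (intro sum.cong refl) (simp add: algebra_simps)
    also have "(\<Sum>j\<le>Suc d. real ((d + j + 1) choose (2 * j + 1)) * (z - u) ^ (2 * j)) = Q d"
      unfolding Q_def by (simp add: binomial_eq_0)
    finally show ?thesis .
  qed
  have IH: "(1 + u^2) * P d = z ^ (2 * d) + u ^ (2 * d + 2)"
    "(1 + u^2) * (z - u)^2 * Q d = (1 - u^2) * (z ^ (2 * d + 2) - u ^ (2 * d + 2))"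
    using Suc.IH unfolding P_def Q_def by auto
  have zu: "z ^ 2 * u ^ 2 = 1"
    using assms by (metis power_mult_distrib power_one)
  have P': "(1 + u^2) * P (Suc d) = z ^ (2 * d + 2) + u ^ (2 * d + 4)"
  proof -
    have "(1 + u^2) * P (Suc d) = z ^ (2 * d) + u ^ (2 * d + 2)
        + (1 - u^2) * (z ^ (2 * d + 2) - u ^ (2 * d + 2))"
      unfolding P IH[symmetric] by algebra
    \<comment> \<open>The last term isolates the only use of \<open>z * u = 1\<close>; the equation
      itself is an identity in independent \<open>z\<close> and \<open>u\<close>.\<close>
    also have "\<dots> = z ^ (2 * d + 2) + u ^ (2 * d + 4) + z ^ (2 * d) * (1 - z^2 * u^2)"
      by (simp add: algebra_simps power_add power2_eq_square eval_nat_numeral)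
    finally show ?thesis by (simp add: zu)
  qed
  have "(1 + u^2) * (z - u)^2 * Q (Suc d) = (1 - u^2) * (z ^ (2 * d + 2) - u ^ (2 * d + 2))
      + (z - u)^2 * (z ^ (2 * d + 2) + u ^ (2 * d + 4))"
    unfolding Q IH[symmetric] P'[symmetric] by algebra
  also have "\<dots> = (1 - u^2) * (z ^ (2 * d + 4) - u ^ (2 * d + 4))"
  proof -
    \<comment> \<open>Naming the powers with symbolic exponent leaves a polynomial identity modulo
      \<open>z * u = 1\<close>, which \<open>algebra\<close> can decide.\<close>
    define a where "a = z ^ (2 * d)"
    define b where "b = u ^ (2 * d)"
    have e: "z ^ (2 * d + 2) = a * z^2" "z ^ (2 * d + 4) = a * z^4"
      "u ^ (2 * d + 2) = b * u^2" "u ^ (2 * d + 4) = b * u^4"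
      unfolding a_def b_def by (simp_all add: power_add power2_eq_square)
    show ?thesis
      unfolding e using assms by algebra
  qed
  finally have Q': "(1 + u^2) * (z - u)^2 * Q (Suc d) = (1 - u^2) * (z ^ (2 * d + 4) - u ^ (2 * d + 4))" .
  have exps: "2 * Suc d = 2 * d + 2" "2 * d + 2 + 2 = 2 * d + 4" by auto
  show ?case
    using P' Q' unfolding P_def Q_def exps by (rule conjI)
qed

lemma odd_cosh_expansion:
  fixes z :: real
  assumes "z > 0"
  shows "(1 + 1 / z^2) * (\<Sum>j\<le>d. real ((d + j) choose (2 * j)) * (z - 1 / z) ^ (2 * j))
           = z ^ (2 * d) + 1 / z ^ (2 * d + 2)"
  using odd_cosh_expansion_aux[of z "1 / z" d] assms by (simp add: power_divide)

section \<open>The substitution y = z - 1/z (Cauchy-Schloemilch)\<close>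

text \<open>The inverse is the positive root of \<open>z^2 - y * z - 1 = 0\<close>. Its square root
  simplifies because \<open>(z - 1 / z)^2 + 4 = (z + 1 / z)^2\<close>.\<close>

lemma bij_betw_diff_inverse: "bij_betw (\<lambda>z::real. z - 1 / z) {1<..} {0<..}"
proof (rule bij_betw_byWitness[where f' = "\<lambda>y. (y + sqrt (y^2 + 4)) / 2"])
  show "\<forall>z\<in>{1<..}. (z - 1 / z + sqrt ((z - 1 / z)^2 + 4)) / 2 = (z::real)"
  proof
    fix z :: real assume z: "z \<in> {1<..}"
    then have "(z - 1 / z)^2 + 4 = (z + 1 / z)^2"
      by (simp add: power2_eq_square field_simps)
    then have "sqrt ((z - 1 / z)^2 + 4) = z + 1 / z"
      using z by simp
    then show "(z - 1 / z + sqrt ((z - 1 / z)^2 + 4)) / 2 = z" by simp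
  qed
next
  have *: "sqrt (y^2 + 4) > 2" if "y > 0" for y :: real
    using that by (intro real_less_rsqrt) simp
  show "\<forall>y\<in>{0<..}. (y + sqrt (y^2 + 4)) / 2 - 1 / ((y + sqrt (y^2 + 4)) / 2) = (y::real)"
  proof
    fix y :: real assume y: "y \<in> {0<..}"
    define r where "r = sqrt (y^2 + 4)"
    have "r^2 = y^2 + 4" "r > 2" "y > 0" using y *[of y] by (auto simp: r_def)
    then show "(y + sqrt (y^2 + 4)) / 2 - 1 / ((y + sqrt (y^2 + 4)) / 2) = y"
      unfolding r_def[symmetric] by (simp add: field_simps power2_eq_square)
  qed
  show "(\<lambda>y::real. (y + sqrt (y^2 + 4)) / 2) ` {0<..} \<subseteq> {1<..}"
    using * by (force intro!: add_pos_pos)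
  show "(\<lambda>z::real. z - 1 / z) ` {1<..} \<subseteq> {0<..}"
  proof clarsimp
    fix z :: real assume "1 < z"
    then have "1 / z < 1" by simp
    with \<open>1 < z\<close> show "1 / z < z" by linarith
  qed
qed

text \<open>The argument of \<open>F\<close> is invariant under inversion, so the part over (0,1)
  can be folded onto (1,infinity). There the two parts add up to \<open>F\<close> times
  \<open>z ^ (2 * d) + 1 / z ^ (2 * d + 2)\<close>, which by \<open>odd_cosh_expansion\<close> is a
  polynomial in \<open>y = z - 1 / z\<close> times the derivative of \<open>y\<close>. Hence only
  even moments of \<open>F (y^2)\<close> enter.\<close>

lemma has_integral_schloemilch:
  fixes F :: "real \<Rightarrow> real"
  assumes cont: "continuous_on {0..} F" and nonneg: "\<And>x. x \<ge> 0 \<Longrightarrow> F x \<ge> 0"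
    and int: "\<And>j. j \<le> d \<Longrightarrow> ((\<lambda>y. y ^ (2 * j) * F (y^2)) has_integral b j) {0<..}"
  shows "((\<lambda>z. F ((z - 1 / z)^2) / z ^ (2 * d + 2)) has_integral
           (\<Sum>j\<le>d. real ((d + j) choose (2 * j)) * b j)) {0<..}"
proof -
  define B where "B = (\<Sum>j\<le>d. real ((d + j) choose (2 * j)) * b j)"
  define \<phi> where "\<phi> z = F ((z - 1 / z)^2) / z ^ (2 * d + 2)" for z
  define \<psi> where "\<psi> z = F ((z - 1 / z)^2) * z ^ (2 * d)" for z
  have PF: "((\<lambda>y. \<Sum>j\<le>d. real ((d + j) choose (2 * j)) * (y ^ (2 * j) * F (y^2))) has_integral B) {0<..}"
    unfolding B_def using int by (intro has_integral_sum has_integral_mult_right) auto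
  have pullback: "\<phi> z + \<psi> z = \<bar>1 + 1 / z^2\<bar> * (\<Sum>j\<le>d. real ((d + j) choose (2 * j)) *
       ((z - 1 / z) ^ (2 * j) * F ((z - 1 / z)^2)))" if "z \<in> {1<..}" for z
  proof -
    have "\<bar>1 + 1 / z^2\<bar> = 1 + 1 / z^2" by (simp add: add_nonneg_nonneg)
    moreover have "\<phi> z + \<psi> z = F ((z - 1 / z)^2) * (z ^ (2 * d) + 1 / z ^ (2 * d + 2))"
      by (simp add: \<phi>_def \<psi>_def algebra_simps)
    moreover have "(\<Sum>j\<le>d. real ((d + j) choose (2 * j)) * ((z - 1 / z) ^ (2 * j) * F ((z - 1 / z)^2)))
        = (\<Sum>j\<le>d. real ((d + j) choose (2 * j)) * (z - 1 / z) ^ (2 * j)) * F ((z - 1 / z)^2)"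
      by (simp add: sum_distrib_right mult.assoc)
    ultimately show ?thesis
      using odd_cosh_expansion[of z d] that by (simp add: mult_ac)
  qed
  have deriv: "((\<lambda>z. z - 1 / z) has_field_derivative 1 + 1 / z^2) (at z within {1<..})"
    if "z \<in> {1<..}" for z :: real
    using that by (auto intro!: derivative_eq_intros simp: power2_eq_square)
  have bij: "inj_on (\<lambda>z::real. z - 1 / z) {1<..}" "(\<lambda>z::real. z - 1 / z) ` {1<..} = {0<..}"
    using bij_betw_diff_inverse by (auto simp only: bij_betw_def)
  have sum: "((\<lambda>z. \<phi> z + \<psi> z) has_integral B) {1<..}"
  proof (rule has_integral_nonneg_substitution[OF _ deriv bij _ PF pullback])
    show "(\<Sum>j\<le>d. real ((d + j) choose (2 * j)) * (y ^ (2 * j) * F (y^2))) \<ge> 0"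
      if "y \<in> {0<..}" for y
      by (intro sum_nonneg mult_nonneg_nonneg nonneg zero_le_even_power) auto
  qed auto
  \<comment> \<open>So far only the sum of \<open>\<phi>\<close> and \<open>\<psi>\<close> is
    integrable. As both are nonnegative, the sum dominates \<open>\<phi>\<close>, whose
    measurability comes from continuity. The value \<open>b1\<close> stays unknown and cancels
    below.\<close>
  have "continuous_on {1<..} \<phi>"
    unfolding \<phi>_def
    by (intro continuous_intros continuous_on_compose2[OF cont]) auto
  then have "\<phi> absolutely_integrable_on {1<..}"
    using sum
    by (intro measurable_bounded_by_integrable_imp_absolutely_integrable[where g = "\<lambda>z. \<phi> z + \<psi> z"]
          continuous_imp_measurable_on_sets_lebesgue)
       (auto simp: \<phi>_def \<psi>_def nonneg)
  then obtain b1 where b1: "(\<phi> has_integral b1) {1<..}"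
    using set_lebesgue_integral_eq_integral(1) by blast
  have \<psi>: "(\<psi> has_integral B - b1) {1<..}"
    using has_integral_diff[OF sum b1] by simp
  have img: "(\<lambda>z::real. 1 / z) ` {0<..<1} = {1<..}"
  proof (intro equalityI subsetI)
    fix x :: real assume "x \<in> {1<..}"
    then have "1 / x \<in> {0<..<1}" "x = 1 / (1 / x)" by auto
    then show "x \<in> (\<lambda>z::real. 1 / z) ` {0<..<1}" by blast
  qed auto
  \<comment> \<open>Inversion carries \<open>\<psi>\<close> on (1,infinity) to \<open>\<phi>\<close>
    on (0,1): the Jacobian \<open>1 / z^2\<close> supplies the two missing powers of
    \<open>z\<close>.\<close>
  have "(\<phi> has_integral B - b1) {0<..<1}"
  proof (rule has_integral_nonneg_substitution[OF _ _ _ img _ \<psi>])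
    show "((\<lambda>z. 1 / z) has_field_derivative - (1 / z^2)) (at z within {0<..<1})"
      if "z \<in> {0<..<1}" for z :: real
      using that by (auto intro!: derivative_eq_intros simp: power2_eq_square)
    show "\<phi> z = \<bar>- (1 / z^2)\<bar> * \<psi> (1 / z)" if "z \<in> {0<..<1}" for z
    proof -
      have "\<psi> (1 / z) = F ((z - 1 / z)^2) / z ^ (2 * d)"
        unfolding \<psi>_def using power2_commute[of "1 / z" z] by (simp add: power_divide)
      then show ?thesis
        using that by (simp add: \<phi>_def power_add mult.commute) (simp add: power2_eq_square)
    qed
  qed (auto simp: inj_on_def \<psi>_def nonneg)
  then have "(\<phi> has_integral B - b1 + b1) ({0<..<1} \<union> {1<..})"
  proof (intro has_integral_Un b1)
    have "{0<..<1} \<inter> {1<..} = ({} :: real set)" by auto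
    then show "negligible ({0<..<1} \<inter> {1<..} :: real set)" by simp
  qed
  then have "(\<phi> has_integral B) (insert 1 ({0<..<1} \<union> {1<..}))"
    using has_integral_insert_point by fastforce
  also have "insert 1 ({0<..<1} \<union> {1<..}) = {0::real<..}" by auto
  finally have "(\<phi> has_integral B) {0<..}" .
  then show ?thesis unfolding \<phi>_def B_def .
qed

section \<open>Beta integrals at half-integers\<close>

lemma Gamma_nat_plus_half:
  "Gamma (real n + 1 / 2) = sqrt pi * fact (2 * n) / (4 ^ n * fact n)"
proof (induction n)
  case (Suc n)
  have "real n + 1 / 2 \<notin> \<int>\<^sub>\<le>\<^sub>0"
    using nonpos_Ints_nonpos[of "real n + 1 / 2"] by fastforce
  then have "Gamma (real (Suc n) + 1 / 2) = (real n + 1 / 2) * Gamma (real n + 1 / 2)"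
    using Gamma_plus1[of "real n + 1 / 2"] by (simp add: add_ac)
  also have "\<dots> = sqrt pi * fact (2 * Suc n) / (4 ^ Suc n * fact (Suc n))"
    unfolding Suc by (simp add: divide_simps) (simp add: algebra_simps)
  finally show ?case .
qed (simp add: Gamma_one_half_real)

text \<open>For \<open>j \<le> m\<close> this is the integral of
  \<open>y ^ (2 * j) / (y^2 + 1) ^ (m + 1)\<close> over the positive half-line. The three binomials
  are kept apart because they reappear as factors of \<open>t_coeff\<close>.\<close>

definition wallis_coeff :: "nat \<Rightarrow> nat \<Rightarrow> real" where
  "wallis_coeff m j = pi / (2 * 4 ^ m) * real ((2 * j) choose j)
     * real ((2 * (m - j)) choose (m - j)) / real (m choose j)"

lemma Beta_half_integers:
  assumes "j \<le> m"
  shows "Beta (real j + 1 / 2) (real (m - j) + 1 / 2) = 2 * wallis_coeff m j"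
proof -
  have "Beta (real j + 1 / 2) (real (m - j) + 1 / 2) =
     Gamma (real j + 1 / 2) * Gamma (real (m - j) + 1 / 2) / fact m"
    using assms Gamma_fact[of m, where 'a = real] by (simp add: Beta_def of_nat_diff add_ac)
  also have "\<dots> = pi * (fact (2 * j) / fact j) * (fact (2 * (m - j)) / fact (m - j))
      / (4 ^ j * 4 ^ (m - j) * fact m)"
    unfolding Gamma_nat_plus_half by (simp add: field_simps)
  also have "4 ^ j * 4 ^ (m - j) = (4 ^ m :: real)"
    using assms by (simp flip: power_add)
  also have "pi * (fact (2 * j) / fact j) * (fact (2 * (m - j)) / fact (m - j)) / (4 ^ m * fact m)
      = 2 * wallis_coeff m j"
  proof -
    have "2 * (m - j) - (m - j) = m - j" "2 * j - j = j" by auto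
    then show ?thesis
      using assms by (simp add: wallis_coeff_def binomial_fact mult_ac del: diff_mult_distrib2)
  qed
  finally show ?thesis .
qed

text \<open>Substituting \<open>t = y^2 / (y^2 + p)\<close>, with
  \<open>1 - t = p / (y^2 + p)\<close>, in the Beta integral with parameters \<open>j + 1/2\<close>
  and \<open>m - j + 1/2\<close> gives the integrand up to the constant
  \<open>2 * p powr (\<beta> + 1)\<close>.\<close>

lemma has_integral_wallis:
  fixes p :: real
  assumes p: "p > 0" and j: "j \<le> m"
  shows "((\<lambda>y. y ^ (2 * j) * (1 / (y^2 + p) ^ (m + 1))) has_integral
           wallis_coeff m j * p powr (real j - real m - 1 / 2)) {0<..}"
proof -
  define \<alpha> where "\<alpha> = real j - 1 / 2"
  define \<beta> where "\<beta> = real m - real j - 1 / 2"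
  define f where "f t = t powr \<alpha> * (1 - t) powr \<beta>" for t :: real
  define g where "g y = y^2 / (y^2 + p)" for y :: real
  define g' where "g' y = 2 * p * y / (y^2 + p)^2" for y :: real
  have f: "(f has_integral 2 * wallis_coeff m j) {0<..<1}"
    using has_integral_Beta_real[of "real j + 1/2" "real (m - j) + 1/2"] j
    unfolding Beta_half_integers[OF j] f_def \<alpha>_def \<beta>_def
    by (simp add: has_integral_Icc_iff_Ioo of_nat_diff diff_diff_eq)
  have pos: "y^2 + p > 0" for y using p by (simp add: add_nonneg_pos)
  have deriv: "(g has_field_derivative g' y) (at y within {0<..})" for y
    unfolding g_def g'_def using pos[of y]
    by (auto intro!: derivative_eq_intros simp: field_simps power2_eq_square)
  have inj: "inj_on g {0<..}"
  proof (rule inj_onI)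
    fix x y assume "x \<in> {0<..}" "y \<in> {0<..}" "g x = g y"
    then have "x^2 * p = y^2 * p"
      using pos[of x] pos[of y] by (simp add: g_def field_simps)
    then show "x = y" using p \<open>x \<in> _\<close> \<open>y \<in> _\<close> by (simp add: power2_eq_iff_nonneg)
  qed
  have img: "g ` {0<..} = {0<..<1}"
  proof (intro equalityI subsetI)
    fix t :: real assume t: "t \<in> {0<..<1}"
    then have "sqrt (p * t / (1 - t)) \<in> {0<..}" using p by simp
    moreover have "t = g (sqrt (p * t / (1 - t)))"
      using t p by (simp add: g_def) (simp add: field_simps)
    ultimately show "t \<in> g ` {0<..}" by blast
  next
    fix t assume "t \<in> g ` {0<..}"
    then obtain y where "y > 0" "t = g y" by auto
    then show "t \<in> {0<..<1}" using pos[of y] p by (simp add: g_def)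
  qed
  have "((\<lambda>y. 2 * p powr (\<beta> + 1) * (y ^ (2 * j) * (1 / (y^2 + p) ^ (m + 1))))
      has_integral 2 * wallis_coeff m j) {0<..}"
  proof (rule has_integral_nonneg_substitution[OF _ deriv inj img _ f])
    fix y :: real assume "y \<in> {0<..}"
    then have y: "y > 0" by simp
    define D where "D = y^2 + p"
    have D: "D > 0" using pos by (simp add: D_def)
    have gy: "g y = y^2 / D" "1 - g y = p / D"
      using D by (auto simp: g_def D_def field_simps)
    have "(y^2) powr \<alpha> = y powr (2 * \<alpha>)"
      using y powr_powr[of y 2 \<alpha>] by simp
    then have "f (g y) = y powr (2 * \<alpha>) * p powr \<beta> / (D powr \<alpha> * D powr \<beta>)"
      unfolding f_def gy(2) unfolding gy(1) using D y p by (simp add: powr_divide)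
    also have "D powr \<alpha> * D powr \<beta> = D powr (real m - 1)"
      by (simp add: \<alpha>_def \<beta>_def flip: powr_add)
    finally have fg: "f (g y) = y powr (2 * \<alpha>) * p powr \<beta> / D powr (real m - 1)" .
    have "\<bar>g' y\<bar> = 2 * p * y / D^2"
      using y p by (simp add: g'_def D_def)
    \<comment> \<open>Every factor is written as a \<open>powr\<close> so that the exponents merge:
      \<open>1 + 2 * \<alpha> = 2 * j\<close> for \<open>y\<close>, and
      \<open>2 + (m - 1) = m + 1\<close> for \<open>D\<close>.\<close>
    then have "\<bar>g' y\<bar> * f (g y) = 2 * (p powr 1 * p powr \<beta>) * (y powr 1 * y powr (2 * \<alpha>))
        / (D powr 2 * D powr (real m - 1))"
      unfolding fg using y p D by simp
    also have "\<dots> = 2 * p powr (\<beta> + 1) * y powr real (2 * j) / D powr real (m + 1)"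
      unfolding powr_add[symmetric] by (simp add: \<alpha>_def add.commute)
    also have "\<dots> = 2 * p powr (\<beta> + 1) * (y ^ (2 * j) * (1 / D ^ (m + 1)))"
      unfolding powr_realpow[OF y] powr_realpow[OF D] by simp
    finally show "2 * p powr (\<beta> + 1) * (y ^ (2 * j) * (1 / (y^2 + p) ^ (m + 1))) = \<bar>g' y\<bar> * f (g y)"
      by (simp add: D_def)
  qed (auto simp: f_def)
  from has_integral_mult_right[OF this, of "1 / (2 * p powr (\<beta> + 1))"]
  have "((\<lambda>y. y ^ (2 * j) * (1 / (y^2 + p) ^ (m + 1))) has_integral
      wallis_coeff m j * (1 / p powr (\<beta> + 1))) {0<..}"
    using p by simp
  moreover have "1 / p powr (\<beta> + 1) = p powr (real j - real m - 1 / 2)"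
    using powr_minus_divide[of p "\<beta> + 1"] by (simp add: \<beta>_def algebra_simps)
  ultimately show ?thesis by simp
qed

section \<open>Quartic integrals\<close>

text \<open>\<open>has_integral_schloemilch\<close> for \<open>F x = 1 / (x + p) ^ (m + 1)\<close>.
  The bound \<open>d \<le> m\<close> keeps every moment index \<open>j \<le> m\<close>, where the
  Beta integrals converge.\<close>

lemma has_integral_symmetric_quartic:
  fixes p :: real
  assumes p: "p > 0" and d: "d \<le> m"
  shows "((\<lambda>v. 1 / (((v - 1 / v)^2 + p) ^ (m + 1) * v ^ (2 * d + 2))) has_integral
           (\<Sum>j\<le>d. real ((d + j) choose (2 * j)) *
             (wallis_coeff m j * p powr (real j - real m - 1 / 2)))) {0<..}"
proof -
  have "((\<lambda>v. 1 / ((v - 1 / v)^2 + p) ^ (m + 1) / v ^ (2 * d + 2)) has_integral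
           (\<Sum>j\<le>d. real ((d + j) choose (2 * j)) *
             (wallis_coeff m j * p powr (real j - real m - 1 / 2)))) {0<..}"
  proof (rule has_integral_schloemilch)
    show "continuous_on {0..} (\<lambda>x::real. 1 / (x + p) ^ (m + 1))"
      using p by (intro continuous_on_divide continuous_on_power continuous_on_add
          continuous_on_const continuous_on_id) auto
    show "1 / (x + p) ^ (m + 1) \<ge> 0" if "x \<ge> 0" for x
      using that p by (simp del: power_Suc)
    show "((\<lambda>y. y ^ (2 * j) * (1 / (y^2 + p) ^ (m + 1))) has_integral
        wallis_coeff m j * p powr (real j - real m - 1 / 2)) {0<..}" if "j \<le> d" for j
      using that d by (intro has_integral_wallis p) simp
  qed
  then show ?thesis by (simp add: divide_divide_eq_left)
qed

text \<open>The two cases of \<open>i\<close> are exchanged by the inversion \<open>w \<mapsto> s / w\<close>.\<close>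

lemma has_integral_quartic:
  fixes q s :: real
  assumes s: "s > 0" and pos: "q + 2 * s > 0" and d: "d \<le> m"
    and i: "i + d = m \<and> e = - real d - 1 \<or> i = m + 1 + d \<and> e = real d"
  shows "((\<lambda>w. w ^ (2 * i) * (1 / (w ^ 4 + q * w^2 + s^2) ^ (m + 1))) has_integral
           (\<Sum>j\<le>d. real ((d + j) choose (2 * j)) * wallis_coeff m j *
             (q + 2 * s) powr (real j - real m - 1 / 2) * s powr (e - real j))) {0<..}"
proof -
  define r where "r = sqrt s"
  \<comment> \<open>Since \<open>(w / r - r / w)^2 = w^2 / s - 2 + s / w^2\<close>, this
    \<open>p\<close> makes the quartic equal to \<open>s * w^2 * ((w / r - r / w)^2 + p)\<close>,
    and the hypothesis on \<open>q + 2 * s\<close> becomes \<open>p > 0\<close>.\<close>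
  define p where "p = (q + 2 * s) / s"
  have r: "r > 0" "r^2 = s"
    using s by (auto simp: r_def)
  have p: "p > 0"
    unfolding p_def using pos s by (rule divide_pos_pos)
  define K where "K = (\<Sum>j\<le>d. real ((d + j) choose (2 * j)) *
             (wallis_coeff m j * p powr (real j - real m - 1 / 2)))"
  define f where "f v = 1 / (((v - 1 / v)^2 + p) ^ (m + 1) * v ^ (2 * d + 2))" for v
  define D where "D w = w ^ 4 + q * w^2 + s^2" for w
  have f: "(f has_integral K) {0<..}"
    unfolding f_def K_def by (rule has_integral_symmetric_quartic[OF p d])
  have f_nonneg: "f v \<ge> 0" if "v \<in> {0<..}" for v
    using that p by (simp add: f_def add_nonneg_pos)
  have quad: "(w / r - r / w)^2 + p = D w / (s * w^2)" if "w > 0" for w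
  proof -
    have sq: "(w / r - r / w)^2 = w^2 / s - 2 + s / w^2"
      using that r by (simp add: power2_diff power_divide)
    show ?thesis
      unfolding sq using that s by (simp add: p_def D_def field_simps power2_eq_square power4_eq_xxxx)
  qed
  have D: "D w > 0" if "w > 0" for w
  proof -
    have "0 < D w / (s * w^2)"
      unfolding quad[OF that, symmetric] using p by (simp add: add_nonneg_pos)
    moreover have "0 < s * w^2" using that s by simp
    ultimately show ?thesis by (simp add: zero_less_divide_iff)
  qed
  \<comment> \<open>The exponent \<open>e\<close> is chosen so that both cases share one prefactor;
    they differ in using \<open>v = w / r\<close> or \<open>v = r / w\<close>.\<close>
  have scale: "((\<lambda>w. w ^ (2 * i) * (1 / D w ^ (m + 1))) has_integral s powr (e - real m - 1 / 2) * K) {0<..}"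
    using i
  proof
    assume i: "i + d = m \<and> e = - real d - 1"
    have img: "(\<lambda>w. w / r) ` {0<..} = {0<..}"
    proof (intro equalityI subsetI)
      fix x :: real assume "x \<in> {0<..}"
      then have "x * r \<in> {0<..}" "x = x * r / r" using r by auto
      then show "x \<in> (\<lambda>w. w / r) ` {0<..}" by blast
    qed (use r in auto)
    \<comment> \<open>The integrand gives \<open>r ^ (2 * m + 2 * d + 4)\<close>, and the derivative
      \<open>1 / r\<close> removes one factor. The power of \<open>w\<close> is
      \<open>2 * m - 2 * d = 2 * i\<close>.\<close>
    have "((\<lambda>w. r ^ (2 * m + 2 * d + 3) * (w ^ (2 * i) * (1 / D w ^ (m + 1)))) has_integral K) {0<..}"
    proof (rule has_integral_nonneg_substitution[OF _ _ _ img _ f])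
      show "((\<lambda>w. w / r) has_field_derivative 1 / r) (at w within {0<..})" for w
        using r by (auto intro!: derivative_eq_intros)
      show "r ^ (2 * m + 2 * d + 3) * (w ^ (2 * i) * (1 / D w ^ (m + 1))) = \<bar>1 / r\<bar> * f (w / r)"
        if "w \<in> {0<..}" for w
      proof -
        have w: "w > 0" using that by simp
        have "f (w / r) = (s * w^2) ^ (m + 1) / D w ^ (m + 1) * (r ^ (2 * d + 2) / w ^ (2 * d + 2))"
          unfolding f_def using quad[OF w] by (simp add: power_divide)
        also have "\<dots> = r ^ (2 * m + 2 * d + 4) * (w ^ (2 * m + 2) / w ^ (2 * d + 2)) / D w ^ (m + 1)"
        proof -
          have e: "2 * m + 2 * d + 4 = 2 * (m + 1) + (2 * d + 2)" by simp
          have "(s * w^2) ^ (m + 1) * r ^ (2 * d + 2) = r ^ (2 * m + 2 * d + 4) * w ^ (2 * (m + 1))"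
            unfolding r(2)[symmetric] power_mult_distrib e power_add[of r "2 * (m + 1)"]
              power_mult[symmetric]
            by (simp only: mult_ac)
          then show ?thesis by (simp add: divide_divide_eq_left mult_ac)
        qed
        also have "w ^ (2 * m + 2) / w ^ (2 * d + 2) = w ^ (2 * i)"
          using w d i by (subst power_diff[symmetric]) (auto intro!: arg_cong[where f = "power w"])
        also have "r ^ (2 * m + 2 * d + 4) = r * r ^ (2 * m + 2 * d + 3)"
        proof -
          have "2 * m + 2 * d + 4 = Suc (2 * m + 2 * d + 3)" by simp
          then show ?thesis by (simp only: power_Suc)
        qed
        finally show ?thesis using r(1) by simp
      qed
    qed (use r f_nonneg in \<open>auto simp: inj_on_def\<close>)
    from has_integral_mult_right[OF this, of "1 / r ^ (2 * m + 2 * d + 3)"]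
    have "((\<lambda>w. w ^ (2 * i) * (1 / D w ^ (m + 1))) has_integral 1 / r ^ (2 * m + 2 * d + 3) * K) {0<..}"
      using r by simp
    moreover have "1 / r ^ (2 * m + 2 * d + 3) = s powr (e - real m - 1 / 2)"
    proof -
      have "1 / r ^ (2 * m + 2 * d + 3) = r powr - real (2 * m + 2 * d + 3)"
        using r by (simp only: powr_minus powr_realpow inverse_eq_divide)
      also have "\<dots> = s powr (- real (2 * m + 2 * d + 3) / 2)"
        unfolding r_def using s by (simp add: powr_half_sqrt[symmetric] powr_powr)
      also have "- real (2 * m + 2 * d + 3) / 2 = e - real m - 1 / 2"
        using i by (simp add: field_simps)
      finally show ?thesis .
    qed
    ultimately show ?thesis by (simp only:)
  next
    assume i: "i = m + 1 + d \<and> e = real d"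
    have img: "(\<lambda>w. r / w) ` {0<..} = {0<..}"
    proof (intro equalityI subsetI)
      fix x :: real assume "x \<in> {0<..}"
      then have "r / x \<in> {0<..}" "x = r / (r / x)" using r by auto
      then show "x \<in> (\<lambda>w. r / w) ` {0<..}" by blast
    qed (use r in auto)
    \<comment> \<open>Here \<open>w ^ (2 * d + 2)\<close> lands in the numerator, giving
      \<open>w ^ (2 * i + 2)\<close> in total; the derivative \<open>r / w^2\<close> cancels the
      surplus square and adds the odd factor \<open>r\<close>.\<close>
    have "((\<lambda>w. r ^ (2 * (m - d) + 1) * (w ^ (2 * i) * (1 / D w ^ (m + 1)))) has_integral K) {0<..}"
    proof (rule has_integral_nonneg_substitution[OF _ _ _ img _ f])
      show "((\<lambda>w. r / w) has_field_derivative - (r / w^2)) (at w within {0<..})" if "w \<in> {0<..}" for w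
        using that by (auto intro!: derivative_eq_intros simp: power2_eq_square)
      show "r ^ (2 * (m - d) + 1) * (w ^ (2 * i) * (1 / D w ^ (m + 1))) = \<bar>- (r / w^2)\<bar> * f (r / w)"
        if "w \<in> {0<..}" for w
      proof -
        have w: "w > 0" using that by simp
        have "f (r / w) = (s * w^2) ^ (m + 1) / D w ^ (m + 1) * (w ^ (2 * d + 2) / r ^ (2 * d + 2))"
          unfolding f_def using quad[OF w] by (simp add: power_divide power2_commute)
        also have "\<dots> = (r ^ (2 * m + 2) / r ^ (2 * d + 2)) * (w^2 * w ^ (2 * i)) / D w ^ (m + 1)"
        proof -
          have "2 * (m + 1) + (2 * d + 2) = 2 + 2 * i" using i by simp
          then have "w ^ (2 * (m + 1)) * w ^ (2 * d + 2) = w^2 * w ^ (2 * i)"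
            by (simp only: power_add[symmetric])
          moreover have "(s * w^2) ^ (m + 1) = r ^ (2 * (m + 1)) * w ^ (2 * (m + 1))"
            unfolding r(2)[symmetric] power_mult_distrib power_mult[symmetric] ..
          ultimately show ?thesis by (simp add: mult_ac)
        qed
        also have "r ^ (2 * m + 2) / r ^ (2 * d + 2) = r ^ (2 * (m - d))"
          using r d by (subst power_diff[symmetric]) (auto intro!: arg_cong[where f = "power r"])
        finally show ?thesis using r w by simp
      qed
    qed (use r f_nonneg in \<open>auto simp: inj_on_def\<close>)
    from has_integral_mult_right[OF this, of "1 / r ^ (2 * (m - d) + 1)"]
    have "((\<lambda>w. w ^ (2 * i) * (1 / D w ^ (m + 1))) has_integral 1 / r ^ (2 * (m - d) + 1) * K) {0<..}"
      using r by simp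
    moreover have "1 / r ^ (2 * (m - d) + 1) = s powr (e - real m - 1 / 2)"
    proof -
      have "1 / r ^ (2 * (m - d) + 1) = r powr - real (2 * (m - d) + 1)"
        using r by (simp only: powr_minus powr_realpow inverse_eq_divide)
      also have "\<dots> = s powr (- real (2 * (m - d) + 1) / 2)"
        unfolding r_def using s by (simp add: powr_half_sqrt[symmetric] powr_powr)
      also have "- real (2 * (m - d) + 1) / 2 = e - real m - 1 / 2"
        using i d by (simp add: field_simps of_nat_diff)
      finally show ?thesis .
    qed
    ultimately show ?thesis by (simp only:)
  qed
  have "s powr (e - real m - 1 / 2) * K = (\<Sum>j\<le>d. real ((d + j) choose (2 * j)) * wallis_coeff m j *
             (q + 2 * s) powr (real j - real m - 1 / 2) * s powr (e - real j))"
    unfolding K_def sum_distrib_left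
  proof (intro sum.cong refl)
    fix j
    define x where "x = real j - real m - 1 / 2"
    \<comment> \<open>With \<open>x = j - m - 1/2\<close>, the factor \<open>s powr - x\<close>
      released by \<open>p\<close> lowers the exponent \<open>e - m - 1/2\<close> of
      \<open>s\<close> to \<open>e - j\<close>.\<close>
    have p_powr: "p powr x = (q + 2 * s) powr x * s powr - x"
      unfolding p_def using s pos powr_divide[of "q + 2 * s" s x] powr_minus_divide[of s x] by simp
    have s_powr: "s powr (e - real j) = s powr (e - real m - 1 / 2) * s powr - x"
      by (simp add: x_def flip: powr_add)
    show "s powr (e - real m - 1 / 2) * (real ((d + j) choose (2 * j)) *
          (wallis_coeff m j * p powr (real j - real m - 1 / 2))) =
        real ((d + j) choose (2 * j)) * wallis_coeff m j *
          (q + 2 * s) powr (real j - real m - 1 / 2) * s powr (e - real j)"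
      unfolding x_def[symmetric] p_powr s_powr by (simp only: mult_ac)
  qed
  with scale show ?thesis by (simp add: D_def)
qed

section \<open>Matching the summands with t\<close>

text \<open>Negating the upper entry sends \<open>j - d - 1\<close> to \<open>d + j\<close>, without
  a sign because the lower entry \<open>2 * j\<close> is even. Here \<open>x\<close> stands for
  \<open>m - k\<close>, which is negative when \<open>k > m\<close>.\<close>

lemma gbinomial_reflected:
  assumes "x = real d \<or> x = - real d - 1" and "j \<le> d"
  shows "(x + real j) gchoose (2 * j) = real ((d + j) choose (2 * j))"
  using assms(1)
proof
  assume "x = real d"
  then show ?thesis
    using binomial_gbinomial[of "d + j" "2 * j", where 'a = real] by simp
next
  assume x: "x = - real d - 1"
  have "(x + real j) gchoose (2 * j) = (real (2 * j) - (x + real j) - 1) gchoose (2 * j)"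
    by (subst gbinomial_negated_upper) simp
  also have "real (2 * j) - (x + real j) - 1 = real (d + j)"
    by (simp add: x)
  finally show ?thesis
    by (simp only: binomial_gbinomial)
qed

text \<open>The dictionary is \<open>n = 2 * m + 1 - N\<close>, \<open>k = 2 * m + 1 - i\<close> and
  \<open>e = m - k\<close>. The first binomial of \<open>t_coeff\<close> then has entries
  \<open>N + i\<close> and \<open>N - i\<close>, and symmetry turns the lower one into
  \<open>2 * i\<close>.\<close>

lemma t_coeff_eq:
  assumes c2: "1 + a1 + a2 > 0" and j: "j \<le> d" "d \<le> m"
    and N: "i \<le> N" "N \<le> 2 * m + 1"
    and i: "i + d = m \<and> e = - real d - 1 \<or> i = m + 1 + d \<and> e = real d"
  shows "t_coeff m (2 * m + 1 - N) a1 a2 (2 * m + 1 - i) j =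
    real ((N + i) choose (2 * i)) * (real ((d + j) choose (2 * j)) * wallis_coeff m j *
      (a2 + 4 + 2 * sqrt (2 * (1 + a1 + a2))) powr (real j - real m - 1 / 2)
      * sqrt (2 * (1 + a1 + a2)) powr (e - real j))"
proof -
  define c where "c = 1 + a1 + a2"
  define k where "k = 2 * m + 1 - i"
  have c: "c > 0" using c2 by (simp add: c_def)
  have k: "real m - real k = e" "real k = 2 * real m + 1 - real i"
    using i N by (auto simp: k_def)
  have "sqrt (8 * c) = sqrt (2^2 * (2 * c))" by simp
  then have sq: "sqrt (8 * c) = 2 * sqrt (2 * c)"
    by (simp only: real_sqrt_mult real_sqrt_abs)
  have kn: "2 * m + 1 - i - (2 * m + 1 - N) = N - i" using N by simp
  have up: "4 * real m - real (2 * m + 1 - N) - real k + 2 = real (N + i)"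
    using N k(2) by (simp add: of_nat_diff)
  have "N + i - 2 * i = N - i" "2 * i \<le> N + i" using N by auto
  then have sym: "(N + i) choose (N - i) = (N + i) choose (2 * i)"
    using binomial_symmetric[of "2 * i" "N + i"] by simp
  have g1: "(4 * real m - real (2 * m + 1 - N) - real k + 2) gchoose (N - i)
      = real ((N + i) choose (2 * i))"
    unfolding up by (simp only: sym flip: binomial_gbinomial)
  have "2 * real m - 2 * real j = real (2 * (m - j))"
    using j by (simp add: of_nat_diff)
  then have g2: "(2 * real m - 2 * real j) gchoose (m - j) = real ((2 * (m - j)) choose (m - j))"
    by (simp only: binomial_gbinomial)
  have g3: "(real m - real k + real j) gchoose (2 * j) = real ((d + j) choose (2 * j))"
    unfolding k(1) using i by (intro gbinomial_reflected j) auto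
  \<comment> \<open>The power of 2 splits in two: \<open>2 powr (- (2 * m + 1))\<close> is the
    factor \<open>1 / (2 * 4 ^ m)\<close> of \<open>wallis_coeff\<close>, and the rest joins the
    power of \<open>c\<close> to form a power of \<open>sqrt (2 * c)\<close>.\<close>
  have "2 powr (- (3 * real m + 2 + real k + real j) / 2)
      = (2::real) powr (- real (2 * m + 1)) * 2 powr ((e - real j) / 2)"
    unfolding k(1)[symmetric] powr_add[symmetric] by (simp add: field_simps)
  also have "(2::real) powr (- real (2 * m + 1)) = 1 / (2 * 4 ^ m)"
  proof -
    have "(2::real) ^ (2 * m + 1) = 2 * 4 ^ m" by (simp add: power_mult)
    moreover have "(2::real) powr - real (2 * m + 1) = 1 / 2 powr real (2 * m + 1)"
      by (rule powr_minus_divide)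
    moreover have "(2::real) powr real (2 * m + 1) = 2 ^ (2 * m + 1)"
      by (rule powr_realpow) simp
    ultimately show ?thesis by metis
  qed
  finally have "2 powr (- (3 * real m + 2 + real k + real j) / 2) * c powr ((real m - real k - real j) / 2)
      = 1 / (2 * 4 ^ m) * (2 * c) powr ((e - real j) / 2)"
    using c by (simp add: powr_mult k(1))
  also have "(2 * c) powr ((e - real j) / 2) = sqrt (2 * c) powr (e - real j)"
    using c by (simp add: powr_half_sqrt[symmetric] powr_powr)
  finally have pw: "2 powr (- (3 * real m + 2 + real k + real j) / 2) * c powr ((real m - real k - real j) / 2)
      = 1 / (2 * 4 ^ m) * sqrt (2 * c) powr (e - real j)" .
  have "t_coeff m (2 * m + 1 - N) a1 a2 k j =
      pi * 2 powr (- (3 * real m + 2 + real k + real j) / 2) * c powr ((real m - real k - real j) / 2)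
      * (a2 + 4 + 2 * sqrt (2 * c)) powr (real j - real m - 1 / 2)
      * real ((N + i) choose (2 * i)) * real ((2 * (m - j)) choose (m - j))
      * real ((d + j) choose (2 * j)) * real ((2 * j) choose j) * inverse (real (m choose j))"
    unfolding t_coeff_def Let_def c_def[symmetric] sq g2 g3 kn[folded k_def] g1 ..
  also have "\<dots> = pi * (2 powr (- (3 * real m + 2 + real k + real j) / 2) * c powr ((real m - real k - real j) / 2))
      * (a2 + 4 + 2 * sqrt (2 * c)) powr (real j - real m - 1 / 2)
      * real ((N + i) choose (2 * i)) * real ((2 * (m - j)) choose (m - j))
      * real ((d + j) choose (2 * j)) * real ((2 * j) choose j) * inverse (real (m choose j))"
    by (simp only: mult.assoc)
  finally show ?thesis
    unfolding pw c_def[symmetric] k_def[symmetric] wallis_coeff_def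
    unfolding divide_inverse
    by (simp only: mult_ac mult_1_left)
qed

section \<open>Reduction of the octic and assembly of the sum\<close>

text \<open>Dividing the palindromic octic by \<open>z ^ 4\<close> leaves a polynomial in
  \<open>z - 1 / z\<close>. The extracted \<open>z ^ (4 * (m + 1))\<close>, against
  \<open>z ^ (2 * n)\<close>, leaves \<open>z ^ (2 * N + 2)\<close> in the denominator, which fixes
  \<open>N = 2 * m + 1 - n\<close>.\<close>

lemma octic_eq_quartic:
  fixes z :: real
  assumes "z > 0" and "n + N = 2 * m + 1"
  shows "z ^ (2 * n) / (z ^ 8 + a2 * z ^ 6 + 2 * a1 * z ^ 4 + a2 * z ^ 2 + 1) ^ (m + 1)
    = 1 / (((z - 1 / z)^2)^2 + (a2 + 4) * (z - 1 / z)^2 + 2 * (1 + a1 + a2)) ^ (m + 1)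
        / z ^ (2 * N + 2)"
proof -
  define u where "u = 1 / z"
  have "z * u = 1" using assms by (simp add: u_def)
  then have "z ^ 8 + a2 * z ^ 6 + 2 * a1 * z ^ 4 + a2 * z ^ 2 + 1
      = z ^ 4 * (((z - u)^2)^2 + (a2 + 4) * (z - u)^2 + 2 * (1 + a1 + a2))"
    by algebra
  moreover have "(z ^ 4) ^ (m + 1) = z ^ (2 * n) * z ^ (2 * N + 2)"
  proof -
    have "4 * (m + 1) = 2 * n + (2 * N + 2)" using assms(2) by simp
    then show ?thesis by (simp only: flip: power_mult power_add)
  qed
  ultimately show ?thesis
    using assms(1) by (simp add: power_mult_distrib u_def del: power_Suc)
qed

text \<open>Both ranges of \<open>n\<close> are treated at once: they differ only in which branches
  of the inner bound occur. The outer substitution contributes \<open>(N + i) choose (2 * i)\<close>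
  and the quartic integral \<open>J i\<close> contributes the sum over \<open>j\<close>.\<close>

lemma has_integral_octic:
  fixes a1 a2 :: real
  assumes c2: "1 + a1 + a2 > 0" and c1: "a2 + 4 > - sqrt (8 * (1 + a1 + a2))"
    and n: "n \<le> 2 * m + 1"
  shows "((\<lambda>z. z ^ (2 * n) / (z ^ 8 + a2 * z ^ 6 + 2 * a1 * z ^ 4 + a2 * z ^ 2 + 1) ^ (m + 1))
    has_integral (\<Sum>k = n..2 * m + 1.
       \<Sum>j = 0..(if k \<le> m then m - k else k - m - 1). t_coeff m n a1 a2 k j)) {0..}"
proof -
  define N where "N = 2 * m + 1 - n"
  define s where "s = sqrt (2 * (1 + a1 + a2))"
  define q where "q = a2 + 4"
  define F where "F x = 1 / (x^2 + q * x + s^2) ^ (m + 1)" for x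
  \<comment> \<open>Under \<open>k = 2 * m + 1 - i\<close> the condition \<open>i \<le> m\<close>
    means \<open>k > m\<close>, so these branches appear in opposite order in the bound on
    \<open>j\<close>.\<close>
  define d where "d i = (if i \<le> m then m - i else i - m - 1)" for i
  define e where "e i = (if i \<le> m then - real (d i) - 1 else real (d i))" for i
  define J where "J i = (\<Sum>j\<le>d i. real ((d i + j) choose (2 * j)) * wallis_coeff m j *
             (q + 2 * s) powr (real j - real m - 1 / 2) * s powr (e i - real j))" for i
  have N: "n = 2 * m + 1 - N" "N \<le> 2 * m + 1" "n + N = 2 * m + 1"
    using n by (auto simp: N_def)
  have s: "s > 0" "s^2 = 2 * (1 + a1 + a2)" using c2 by (auto simp: s_def)
  \<comment> \<open>The hypothesis on \<open>a2 + 4\<close> is exactly \<open>q + 2 * s > 0\<close>.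
    Completing the square as \<open>(x - s)^2 + (q + 2 * s) * x\<close> then keeps the denominator
    of \<open>F\<close> positive for \<open>x \<ge> 0\<close>, even if \<open>q\<close> is
    negative.\<close>
  have "sqrt (8 * (1 + a1 + a2)) = sqrt (2^2 * (2 * (1 + a1 + a2)))" by simp
  then have "sqrt (8 * (1 + a1 + a2)) = 2 * s"
    by (simp only: real_sqrt_mult real_sqrt_abs s_def)
  then have qs: "q + 2 * s > 0" using c1 by (simp add: q_def)
  have pos: "x^2 + q * x + s^2 > 0" if "x \<ge> 0" for x
  proof (cases "x = 0")
    case False
    have "x^2 + q * x + s^2 = (x - s)^2 + (q + 2 * s) * x"
      by (simp add: power2_eq_square algebra_simps)
    also have "\<dots> > 0" using False that qs by (intro add_nonneg_pos) auto
    finally show ?thesis .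
  qed (use s(1) in simp)
  have di: "i + d i = m \<and> e i = - real (d i) - 1 \<or> i = m + 1 + d i \<and> e i = real (d i)" for i
    by (auto simp: d_def e_def)
  have dm: "d i \<le> m" if "i \<le> N" for i
    using that N by (auto simp: d_def)
  have "((\<lambda>z. F ((z - 1 / z)^2) / z ^ (2 * N + 2)) has_integral
      (\<Sum>i\<le>N. real ((N + i) choose (2 * i)) * J i)) {0<..}"
  proof (rule has_integral_schloemilch)
    show "continuous_on {0..} F"
      unfolding F_def using pos by (intro continuous_intros) (auto simp: less_imp_neq[symmetric])
    show "F x \<ge> 0" if "x \<ge> 0" for x
      unfolding F_def using pos[OF that] by simp
    show "((\<lambda>y. y ^ (2 * i) * F (y^2)) has_integral J i) {0<..}" if "i \<le> N" for i
      using has_integral_quartic[OF s(1) qs dm[OF that] di]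
      by (simp add: F_def J_def flip: power_mult)
  qed
  also have "(\<Sum>i\<le>N. real ((N + i) choose (2 * i)) * J i) =
      (\<Sum>i\<le>N. \<Sum>j = 0..d i. t_coeff m n a1 a2 (2 * m + 1 - i) j)"
    unfolding J_def sum_distrib_left atLeast0AtMost
  proof (intro sum.cong refl)
    fix i j assume "i \<in> {..N}" "j \<in> {..d i}"
    then show "real ((N + i) choose (2 * i)) * (real ((d i + j) choose (2 * j)) * wallis_coeff m j *
             (q + 2 * s) powr (real j - real m - 1 / 2) * s powr (e i - real j))
        = t_coeff m n a1 a2 (2 * m + 1 - i) j"
      unfolding N(1) q_def s_def by (intro t_coeff_eq[symmetric] c2 di dm N) auto
  qed
  also have "\<dots> = (\<Sum>k = n..2 * m + 1.
       \<Sum>j = 0..(if k \<le> m then m - k else k - m - 1). t_coeff m n a1 a2 k j)"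
    by (rule sum.reindex_bij_witness[of _ "\<lambda>k. 2 * m + 1 - k" "\<lambda>i. 2 * m + 1 - i"])
       (use N in \<open>auto simp: d_def\<close>)
  finally have int: "((\<lambda>z. z ^ (2 * n) / (z ^ 8 + a2 * z ^ 6 + 2 * a1 * z ^ 4 + a2 * z ^ 2 + 1) ^ (m + 1))
    has_integral (\<Sum>k = n..2 * m + 1.
       \<Sum>j = 0..(if k \<le> m then m - k else k - m - 1). t_coeff m n a1 a2 k j)) {0<..}"
  proof (rule has_integral_eq[rotated])
    fix z :: real assume "z \<in> {0<..}"
    then show "F ((z - 1 / z)^2) / z ^ (2 * N + 2) =
        z ^ (2 * n) / (z ^ 8 + a2 * z ^ 6 + 2 * a1 * z ^ 4 + a2 * z ^ 2 + 1) ^ (m + 1)"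
      unfolding F_def q_def s(2) by (intro octic_eq_quartic[symmetric] N(3)) simp
  qed
  have ivl: "insert 0 {0<..} = {0::real..}" by auto
  show ?thesis
    using has_integral_insert_point[OF int, of 0] by (simp only: ivl)
qed

theorem theorem4p1:
  fixes m :: nat and a1 a2 :: real
  assumes "1 + a1 + a2 > 0"
    and "a2 + 4 > - sqrt (8 * (1 + a1 + a2))"
  shows "(\<forall>n::nat. m + 1 \<le> n \<and> n \<le> 2 * m + 1 \<longrightarrow>
           ((\<lambda>z::real. z ^ (2 * n) /
               (z ^ 8 + a2 * z ^ 6 + 2 * a1 * z ^ 4 + a2 * z ^ 2 + 1) ^ (m + 1))
             has_integral
             (\<Sum>k = n..2 * m + 1. \<Sum>j = 0..k - m - 1. t_coeff m n a1 a2 k j)) {0..})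
       \<and> (\<forall>n::nat. n \<le> m \<longrightarrow>
           ((\<lambda>z::real. z ^ (2 * n) /
               (z ^ 8 + a2 * z ^ 6 + 2 * a1 * z ^ 4 + a2 * z ^ 2 + 1) ^ (m + 1))
             has_integral
             ((\<Sum>k = n..m. \<Sum>j = 0..m - k. t_coeff m n a1 a2 k j)
              + (\<Sum>k = m + 1..2 * m + 1. \<Sum>j = 0..k - m - 1. t_coeff m n a1 a2 k j))) {0..})"
proof (intro conjI allI impI)
  fix n assume n: "m + 1 \<le> n \<and> n \<le> 2 * m + 1"
  then have "(\<Sum>k = n..2 * m + 1. \<Sum>j = 0..k - m - 1. t_coeff m n a1 a2 k j) = (\<Sum>k = n..2 * m + 1.
     \<Sum>j = 0..(if k \<le> m then m - k else k - m - 1). t_coeff m n a1 a2 k j)"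
    by (intro sum.cong) auto
  moreover have "n \<le> 2 * m + 1" using n by simp
  ultimately show "((\<lambda>z. z ^ (2 * n) / (z ^ 8 + a2 * z ^ 6 + 2 * a1 * z ^ 4 + a2 * z ^ 2 + 1) ^ (m + 1))
    has_integral (\<Sum>k = n..2 * m + 1. \<Sum>j = 0..k - m - 1. t_coeff m n a1 a2 k j)) {0..}"
    using has_integral_octic[OF assms, of n m] by (simp only:)
next
  fix n assume n: "n \<le> m"
  \<comment> \<open>For \<open>n \<le> m\<close> both branches of the inner bound occur, and cutting
    the range of \<open>k\<close> after \<open>m\<close> separates them.\<close>
  have "{n..2 * m + 1} = {n..m} \<union> {m + 1..2 * m + 1}" using n by auto
  then have "(\<Sum>k = n..2 * m + 1.
     \<Sum>j = 0..(if k \<le> m then m - k else k - m - 1). t_coeff m n a1 a2 k j) =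
     (\<Sum>k = n..m. \<Sum>j = 0..m - k. t_coeff m n a1 a2 k j)
      + (\<Sum>k = m + 1..2 * m + 1. \<Sum>j = 0..k - m - 1. t_coeff m n a1 a2 k j)"
    by (simp only:) (subst sum.union_disjoint, auto intro!: arg_cong2[where f = "(+)"] sum.cong)
  moreover have "n \<le> 2 * m + 1" using n by simp
  ultimately show "((\<lambda>z. z ^ (2 * n) / (z ^ 8 + a2 * z ^ 6 + 2 * a1 * z ^ 4 + a2 * z ^ 2 + 1) ^ (m + 1))
    has_integral (\<Sum>k = n..m. \<Sum>j = 0..m - k. t_coeff m n a1 a2 k j)
      + (\<Sum>k = m + 1..2 * m + 1. \<Sum>j = 0..k - m - 1. t_coeff m n a1 a2 k j)) {0..}"
    using has_integral_octic[OF assms, of n m] by (simp only:)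
qed

end
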